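(* For every $\epsilon > 0$ and every $Q \in \mathbb{N}$, if $A,B \subseteq \mathbb{Z}/Q\mathbb{Z}$ are nonempty subsets and $B$ intersects every coset of every subgroup of $\mathbb{Z}/Q\mathbb{Z}$ of index at most $\epsilon^{-1}$, then either \[ |A+B| > |A| + |B| - \epsilon Q \] or $A+B = \mathbb{Z}/Q\mathbb{Z}$. *)

theory Defs
  imports Complex_Main "HOL-Algebra.Elementary_Groups"
begin

end

theory Submission
  imports Defs
begin

text \<open>
  Hamidoune's isoperimetric method. Among the nonempty \<open>X\<close> with \<open>X + S \<noteq> G\<close> minimise
  \<open>|X + S| - |X|\<close>, and call the smallest minimisers atoms. Since \<open>X \<mapsto> |X + S|\<close> is submodular,
  and since the negated complement of \<open>X + S\<close> is again a minimiser, two atoms that meet are equal;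
  hence an atom containing \<open>0\<close> is a subgroup \<open>H\<close>. Thus \<open>H + S \<noteq> G\<close> and
  \<open>|A + S| \<ge> |A| + |H + S| - |H|\<close> whenever \<open>A + S \<noteq> G\<close>. In the theorem, \<open>H + B \<noteq> G\<close> forces the
  index of \<open>H\<close> to exceed \<open>1 / \<epsilon>\<close>, that is, \<open>|H| < \<epsilon> Q\<close>.
\<close>

lemma set_mult_iff: "z \<in> X <#>\<^bsub>G\<^esub> Y \<longleftrightarrow> (\<exists>x\<in>X. \<exists>y\<in>Y. z = x \<otimes>\<^bsub>G\<^esub> y)"
  unfolding set_mult_def by auto

lemma finite_set_mult: "finite X \<Longrightarrow> finite Y \<Longrightarrow> finite (X <#>\<^bsub>G\<^esub> Y)"
  unfolding set_mult_def by simp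

lemma set_mult_mono_left: "X \<subseteq> Y \<Longrightarrow> X <#>\<^bsub>G\<^esub> S \<subseteq> Y <#>\<^bsub>G\<^esub> S"
  unfolding set_mult_def by blast

text \<open>Multiplication by \<open>S\<close> commutes with unions, but sends an intersection only
  into the intersection of the products; inclusion-exclusion does the rest.\<close>

lemma card_set_mult_submodular:
  assumes "finite X" "finite Y" "finite S"
  shows "card ((X \<inter> Y) <#>\<^bsub>G\<^esub> S) + card ((X \<union> Y) <#>\<^bsub>G\<^esub> S)
           \<le> card (X <#>\<^bsub>G\<^esub> S) + card (Y <#>\<^bsub>G\<^esub> S)"
proof -
  let ?m = "\<lambda>X. X <#>\<^bsub>G\<^esub> S"
  have "card (?m (X \<inter> Y)) \<le> card (?m X \<inter> ?m Y)"
    using assms by (intro card_mono) (simp_all add: finite_set_mult set_mult_mono_left)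
  moreover have "?m (X \<union> Y) = ?m X \<union> ?m Y"
    unfolding set_mult_def by blast
  ultimately show ?thesis
    using card_Un_Int[of "?m X" "?m Y"] assms by (simp add: finite_set_mult)
qed

lemma (in group) card_translate:
  assumes "g \<in> carrier G" "X \<subseteq> carrier G"
  shows "card ((\<otimes>) g ` X) = card X"
proof -
  have "inj_on ((\<otimes>) g) (carrier G)"
    using assms(1) by (auto intro!: inj_onI)
  then show ?thesis
    using assms(2) by (intro card_image) (rule inj_on_subset)
qed

lemma (in group) set_mult_translate:
  assumes "g \<in> carrier G" "X \<subseteq> carrier G" "S \<subseteq> carrier G"
  shows "((\<otimes>) g ` X) <#> S = (\<otimes>) g ` (X <#> S)"
proof -
  have "g \<otimes> x \<otimes> s = g \<otimes> (x \<otimes> s)" if "x \<in> X" "s \<in> S" for x s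
    using assms that by (auto intro: m_assoc)
  then show ?thesis
    unfolding set_mult_def by (auto; force)
qed

text \<open>The form in which an atom is recognised as a subgroup: \<open>h H \<subseteq> H\<close>
  is closure, and \<open>\<one> \<in> h H\<close> puts the inverse of \<open>h\<close> in
  \<open>H\<close>.\<close>

lemma (in group) subgroup_if_translates_eq:
  assumes "H \<subseteq> carrier G" "\<one> \<in> H"
    and "\<And>h. h \<in> H \<Longrightarrow> (\<otimes>) h ` H = H"
  shows "subgroup H G"
proof
  show "x \<otimes> y \<in> H" if "x \<in> H" "y \<in> H" for x y
    using assms(3)[OF that(1)] that(2) by blast
  show "inv x \<in> H" if x: "x \<in> H" for x
  proof -
    obtain y where "y \<in> H" "\<one> = x \<otimes> y"
      using assms(2) assms(3)[OF x] by (metis image_iff)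
    moreover have "y = inv x"
      using calculation x assms(1) by (metis inv_equality inv_inv inv_closed subsetD)
    ultimately show ?thesis by simp
  qed
qed (use assms in auto)

text \<open>By commutativity \<open>inv x = inv z \<otimes> s\<close> rearranges to
  \<open>z = x \<otimes> s\<close>, which is impossible for \<open>z\<close> outside
  \<open>X <#> S\<close>. Counting then bounds the product of the dual set with \<open>S\<close> by
  \<open>|G| - |X|\<close>.\<close>

lemma (in comm_group) dual_disjoint:
  assumes "X \<subseteq> carrier G" "S \<subseteq> carrier G"
  shows "((m_inv G ` (carrier G - (X <#> S))) <#> S) \<inter> m_inv G ` X = {}"
proof -
  have False if z: "z \<in> carrier G" "z \<notin> X <#> S" and "s \<in> S" "x \<in> X"
    and eq: "inv x = inv z \<otimes> s" for z s x
  proof -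
    have c: "s \<in> carrier G" "x \<in> carrier G"
      using that assms by auto
    have "x \<otimes> s = x \<otimes> (z \<otimes> (inv z \<otimes> s))"
      using z c by (simp add: m_assoc[symmetric])
    also have "\<dots> = z"
      unfolding eq[symmetric] using z c by (metis inv_closed m_lcomm r_inv r_one)
    finally show False
      using z that by (auto simp: set_mult_iff)
  qed
  then show ?thesis by (auto simp: set_mult_iff)
qed

theorem (in comm_group) isoperimetric_subgroup:
  assumes fin: "finite (carrier G)"
    and S: "S \<subseteq> carrier G"
    and A: "A \<subseteq> carrier G" "A \<noteq> {}" "A <#> S \<noteq> carrier G"
  obtains H where "subgroup H G" "H <#> S \<noteq> carrier G"
    "card A + card (H <#> S) \<le> card (A <#> S) + card H"
proof -
  define F where "F = {X. X \<subseteq> carrier G \<and> X \<noteq> {} \<and> X <#> S \<noteq> carrier G}"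
  \<comment> \<open>Integer-valued, because the difference is negative when \<open>S\<close> is
    empty.\<close>
  define d where "d X = int (card (X <#> S)) - int (card X)" for X
  have finF: "finite F"
    unfolding F_def using fin by simp
  have sub: "X \<subseteq> carrier G" and fX: "finite X" and mF: "X <#> S \<subseteq> carrier G"
    and cF: "card (X <#> S) < card (carrier G)" if "X \<in> F" for X
  proof -
    show s: "X \<subseteq> carrier G" using that by (simp add: F_def)
    show "finite X" using s fin by (rule finite_subset)
    show m: "X <#> S \<subseteq> carrier G" using s S by (rule set_mult_closed)
    show "card (X <#> S) < card (carrier G)"
      using m that fin by (intro psubset_card_mono) (auto simp: F_def)
  qed
  have fS: "finite S" using S fin by (rule finite_subset)
  have "A \<in> F" using A by (simp add: F_def)
  then obtain M where "is_arg_min d (\<lambda>X. X \<in> F) M"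
    using ex_is_arg_min_if_finite[OF finF] by blast
  then have M: "M \<in> F" "\<And>X. X \<in> F \<Longrightarrow> d M \<le> d X"
    by (auto simp: is_arg_min_linorder)
  \<comment> \<open>A second minimisation, now of the size among the minimisers of \<open>d\<close>,
    yields an atom \<open>N\<close>.\<close>
  have "finite {X \<in> F. d X = d M}" "{X \<in> F. d X = d M} \<noteq> {}"
    using finF M(1) by auto
  then obtain N where "is_arg_min card (\<lambda>X. X \<in> {X \<in> F. d X = d M}) N"
    using ex_is_arg_min_if_finite by blast
  then have N: "N \<in> F" "d N = d M" "\<And>X. X \<in> F \<Longrightarrow> d X = d M \<Longrightarrow> card N \<le> card X"
    by (auto simp: is_arg_min_linorder)
  have dmin: "d N \<le> d X" if "X \<in> F" for X
    using M(2)[OF that] N(2) by simp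
  have cmin: "card N \<le> card X" if "X \<in> F" "d X \<le> d N" for X
    using N(2,3) dmin that by force

  have translate: "(\<otimes>) g ` X \<in> F \<and> d ((\<otimes>) g ` X) = d X \<and> card ((\<otimes>) g ` X) = card X"
    if g: "g \<in> carrier G" and X: "X \<in> F" for g X
  proof -
    have c: "card (((\<otimes>) g ` X) <#> S) = card (X <#> S)"
      using g sub[OF X] S mF[OF X] by (simp add: set_mult_translate card_translate)
    moreover have "(\<otimes>) g ` X \<subseteq> carrier G" "(\<otimes>) g ` X \<noteq> {}"
      using g X sub[OF X] by (auto simp: F_def)
    ultimately show ?thesis
      using cF[OF X] g sub[OF X] by (auto simp: F_def d_def card_translate)
  qed

  \<comment> \<open>The dual \<open>?D\<close> has size \<open>|G| - |N S|\<close>, while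
    \<open>|?D S| \<le> |G| - |N|\<close>. As \<open>N\<close> is nonempty, \<open>?D\<close> lies
    in \<open>F\<close>, with \<open>d ?D \<le> d N\<close>; so the atom is no larger than
    \<open>?D\<close>.\<close>
  have atom_small: "card (N <#> S) + card N \<le> card (carrier G)"
  proof -
    let ?D = "m_inv G ` (carrier G - (N <#> S))"
    have inj: "inj_on (m_inv G) (carrier G)"
      by (metis inj_onI inv_inv)
    have D: "?D \<subseteq> carrier G" "?D \<noteq> {}"
      using cF[OF N(1)] mF[OF N(1)] N(1) by (auto simp: F_def)
    have cD: "card ?D = card (carrier G) - card (N <#> S)"
      using mF[OF N(1)] fin
      by (subst card_image[OF inj_on_subset[OF inj]]) (auto simp: card_Diff_subset finite_subset)
    have cN: "card (m_inv G ` N) = card N"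
      using inj sub[OF N(1)] by (intro card_image) (auto intro: inj_on_subset)
    have DS: "?D <#> S \<subseteq> carrier G"
      using D(1) S by (rule set_mult_closed)
    have "card (?D <#> S) + card N = card ((?D <#> S) \<union> m_inv G ` N)"
      unfolding cN[symmetric]
      using dual_disjoint[OF sub[OF N(1)] S] DS fin fX[OF N(1)]
      by (subst card_Un_disjoint) (auto intro: finite_subset)
    also have "\<dots> \<le> card (carrier G)"
      using DS fin sub[OF N(1)] by (intro card_mono) auto
    finally have le: "card (?D <#> S) + card N \<le> card (carrier G)" .
    have "N \<noteq> {}" using N(1) by (simp add: F_def)
    then have "card N > 0" using fX[OF N(1)] by (simp add: card_gt_0_iff)
    then have "?D \<in> F" using le D by (auto simp: F_def)
    moreover have "d ?D \<le> d N"
      using le cD cF[OF N(1)] by (simp add: d_def)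
    ultimately show ?thesis using cmin cD cF[OF N(1)] by force
  qed

  have atoms_eq: "N = Y" if Y: "Y \<in> F" "d Y = d N" "card Y = card N" and meet: "N \<inter> Y \<noteq> {}" for Y
  proof (rule ccontr)
    assume "N \<noteq> Y"
    have less: "card (N \<inter> Y) < card N"
    proof (rule psubset_card_mono[OF fX[OF N(1)]])
      show "N \<inter> Y \<subset> N"
        using card_subset_eq[OF fX[OF Y(1)]] Y(3) \<open>N \<noteq> Y\<close> by (metis inf.absorb_iff1 inf_le1 psubsetI)
    qed
    have "(N \<inter> Y) <#> S \<subseteq> N <#> S"
      by (rule set_mult_mono_left) simp
    then have I: "N \<inter> Y \<in> F"
      using N(1) meet mF[OF N(1)] by (auto simp: F_def)
    note dI = dmin[OF I]
    have un: "card (N \<union> Y) + card (N \<inter> Y) = card N + card Y"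
      using card_Un_Int[OF fX[OF N(1)] fX[OF Y(1)]] by simp
    note sm = card_set_mult_submodular[OF fX[OF N(1)] fX[OF Y(1)] fS, of G]
    have pos: "card (N \<inter> Y) > 0"
      using meet fX[OF N(1)] by (simp add: card_gt_0_iff)
    \<comment> \<open>Submodularity and \<open>d N \<le> d (N \<inter> Y)\<close> bound the left
      side by \<open>|N S| + |N| - |N \<inter> Y|\<close>. This is below \<open>|G|\<close> by
      \<open>atom_small\<close>, since the intersection is nonempty.\<close>
    have "card ((N \<union> Y) <#> S) < card (carrier G)"
      using sm dI Y(2,3) pos atom_small by (simp add: d_def)
    then have U: "N \<union> Y \<in> F"
      using N(1) Y(1) by (auto simp: F_def)
    \<comment> \<open>\<open>d\<close> inherits submodularity, and the union costs at least
      \<open>d N\<close>, so at most \<open>d N\<close> is left for the intersection: a minimiser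
      smaller than an atom.\<close>
    have "d (N \<inter> Y) \<le> d N"
      using sm dmin[OF U] un Y(2,3) by (simp add: d_def)
    then show False using cmin[OF I] less by simp
  qed

  obtain n where n: "n \<in> N" using N(1) by (auto simp: F_def)
  then have nG: "n \<in> carrier G" using sub[OF N(1)] by auto
  define H where "H = (\<otimes>) (inv n) ` N"
  have H: "H \<in> F" "d H = d N" "card H = card N"
    using translate[of "inv n" N] N(1) nG by (auto simp: H_def)
  have one: "\<one> \<in> H" using n nG by (force simp: H_def)
  \<comment> \<open>\<open>atoms_eq\<close> only compares sets with \<open>N\<close>, so both sides
    are first moved by \<open>n\<close>. The translates of \<open>H\<close> by \<open>n\<close> and
    by \<open>n \<otimes> h\<close> meet \<open>N\<close> (in \<open>n\<close> and
    \<open>n \<otimes> h\<close>), hence both equal \<open>N\<close>, and \<open>n\<close>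
    cancels.\<close>
  have "(\<otimes>) h ` H = H" if h: "h \<in> H" for h
  proof -
    have hG: "h \<in> carrier G" using h sub[OF H(1)] by auto
    have meeting: "N = (\<otimes>) g ` H" if g: "g \<in> carrier G" "N \<inter> (\<otimes>) g ` H \<noteq> {}" for g
      using translate[OF g(1) H(1)] H g(2) by (intro atoms_eq) auto
    have mul: "(\<otimes>) n ` ((\<otimes>) h ` H) = (\<otimes>) (n \<otimes> h) ` H"
      using sub[OF H(1)] nG hG by (force simp: image_image m_assoc intro!: image_cong)
    have NH: "N = (\<otimes>) n ` H"
      using n nG one by (intro meeting) force+
    have "n \<otimes> h \<in> N \<inter> (\<otimes>) (n \<otimes> h) ` H"
      using NH h one nG hG by (metis IntI image_eqI m_closed r_one)
    then have "N = (\<otimes>) (n \<otimes> h) ` H"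
      using nG hG by (intro meeting) auto
    then have "(\<otimes>) n ` ((\<otimes>) h ` H) = (\<otimes>) n ` H"
      using NH mul by simp
    moreover have "inj_on ((\<otimes>) n) (carrier G)"
      using nG by (auto intro!: inj_onI)
    ultimately show ?thesis
      using sub[OF H(1)] hG
      by (subst (asm) inj_on_image_eq_iff) auto
  qed
  then have "subgroup H G"
    using subgroup_if_translates_eq sub[OF H(1)] one by blast
  moreover have "H <#> S \<noteq> carrier G" using H(1) by (simp add: F_def)
  moreover have "card A + card (H <#> S) \<le> card (A <#> S) + card H"
    using dmin[OF \<open>A \<in> F\<close>] H(2) by (simp add: d_def)
  ultimately show thesis by (rule that)
qed

text \<open>An element \<open>b\<close> of \<open>B\<close> in the coset \<open>H #> x\<close> gives
  \<open>x \<in> H #> b\<close>. Used contrapositively: if \<open>H <#> B\<close> is proper,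
  \<open>B\<close> misses some coset of \<open>H\<close>.\<close>

lemma (in group) set_mult_eq_carrier_if_meets_rcosets:
  assumes "subgroup H G" "B \<subseteq> carrier G"
    and "\<And>C. C \<in> rcosets H \<Longrightarrow> B \<inter> C \<noteq> {}"
  shows "H <#> B = carrier G"
proof
  have H: "H \<subseteq> carrier G" using assms(1) by (rule subgroup.subset)
  then show "H <#> B \<subseteq> carrier G" using assms(2) by (rule set_mult_closed)
  show "carrier G \<subseteq> H <#> B"
  proof
    fix x assume x: "x \<in> carrier G"
    then obtain b where b: "b \<in> B" "b \<in> H #> x"
      using assms(3)[OF rcosetsI[OF H]] by blast
    then have "x \<in> H #> b"
      using repr_independence[OF b(2) x assms(1)] rcos_self[OF x assms(1)] by simp
    then show "x \<in> H <#> B"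
      using b(1) by (auto simp: r_coset_def set_mult_def)
  qed
qed

theorem theorem4p4:
  fixes \<epsilon> :: real and Q :: nat and A B :: "int set"
  assumes "\<epsilon> > 0"
    and "Q \<ge> 1"
    and "A \<subseteq> carrier (integer_mod_group Q)" and "A \<noteq> {}"
    and "B \<subseteq> carrier (integer_mod_group Q)" and "B \<noteq> {}"
    and "\<And>H C. subgroup H (integer_mod_group Q) \<Longrightarrow>
           real (card (rcosets\<^bsub>integer_mod_group Q\<^esub> H)) \<le> inverse \<epsilon> \<Longrightarrow>
           C \<in> rcosets\<^bsub>integer_mod_group Q\<^esub> H \<Longrightarrow> B \<inter> C \<noteq> {}"
  shows "real (card (A <#>\<^bsub>integer_mod_group Q\<^esub> B)) > real (card A) + real (card B) - \<epsilon> * real Q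
         \<or> A <#>\<^bsub>integer_mod_group Q\<^esub> B = carrier (integer_mod_group Q)"
proof (rule disjCI)
  let ?G = "integer_mod_group Q"
  interpret G: comm_group ?G by (rule abelian_integer_mod_group)
  \<comment> \<open>\<open>Q \<ge> 1\<close> matters: \<open>integer_mod_group 0\<close> is the
    infinite group of integers.\<close>
  have car: "carrier ?G = {0..<int Q}"
    using assms(2) by (simp add: carrier_integer_mod_group)
  assume "A <#>\<^bsub>?G\<^esub> B \<noteq> carrier ?G"
  then obtain H where H: "subgroup H ?G" "H <#>\<^bsub>?G\<^esub> B \<noteq> carrier ?G"
    and le: "card A + card (H <#>\<^bsub>?G\<^esub> B) \<le> card (A <#>\<^bsub>?G\<^esub> B) + card H"
    using G.isoperimetric_subgroup[of B A] assms(3-5) car by auto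
  have fB: "finite (H <#>\<^bsub>?G\<^esub> B)"
    using G.set_mult_closed[OF subgroup.subset[OF H(1)] assms(5)] car by (auto intro: finite_subset)
  have "card B \<le> card (H <#>\<^bsub>?G\<^esub> B)"
  proof (rule card_mono[OF fB], rule subsetI)
    fix b assume "b \<in> B"
    then have "b = \<one>\<^bsub>?G\<^esub> \<otimes>\<^bsub>?G\<^esub> b" using assms(5) by (metis G.l_one subsetD)
    then show "b \<in> H <#>\<^bsub>?G\<^esub> B"
      using \<open>b \<in> B\<close> subgroup.one_closed[OF H(1)] unfolding set_mult_iff by blast
  qed
  moreover have "real (card H) < \<epsilon> * real Q"
  proof -
    let ?i = "card (rcosets\<^bsub>?G\<^esub> H)"
    \<comment> \<open>Otherwise \<open>B\<close> would meet every coset of \<open>H\<close>, forcing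
      \<open>H <#> B\<close> to be everything. With index above \<open>inverse \<epsilon>\<close>,
      Lagrange's theorem gives \<open>|H| < \<epsilon> Q\<close>.\<close>
    have "\<not> real ?i \<le> inverse \<epsilon>"
      using G.set_mult_eq_carrier_if_meets_rcosets[OF H(1) assms(5)] assms(7)[OF H(1)] H(2) by blast
    then have "1 < \<epsilon> * real ?i"
      using assms(1) by (simp add: field_simps)
    moreover have "?i * card H = Q"
      using G.lagrange[OF H(1)] car by (simp add: order_def)
    moreover have "card H > 0"
      using calculation(2) assms(2) by (cases "card H") auto
    ultimately show ?thesis
      using mult_strict_right_mono[of 1 "\<epsilon> * real ?i" "real (card H)"]
      by (simp add: mult.assoc flip: of_nat_mult)
  qed
  ultimately show "real (card (A <#>\<^bsub>?G\<^esub> B)) > real (card A) + real (card B) - \<epsilon> * real Q"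
    using le by linarith
qed

end
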